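(* Let $X$ be an infinite locally compact Hausdorff space admitting a countable basis $\mathcal B$ of compact open sets closed under finite intersections, let $W_0$ be the associated space of finite and infinite words in $X$, and let $\alpha:W_0\to\alpha(W_0)\subseteq\{0,1\}^{\mathcal P}$ be the map defined in the context (a homeomorphism onto its image). Define $d(x,y):=d_{\mathrm{fin}}(\alpha(x),\alpha(y))$ for all $x,y\in W_0$. Then $d$ is a metric on $W_0$, and the topology it induces coincides with the generalized cylinder set topology on $W_0$.
   Context: $\mathbb N=\{1,2,\dots\}$. $W_0=X^{\mathbb N}\cup\bigcup_{n\ge0}X^n$ with $X^0=\{\vec 0\}$ (empty word); elements are words $x=x_1x_2\cdots$ with length $\ell(x)\in\{0,1,2,\dots\}\cup\{\infty\}$. Generalized cylinders: for $k\in\mathbb N$, $B_1,\dots,B_k\in\mathcal B$ and $K\subseteq X$ compact open, $Z[B_1\times\cdots\times B_k,K]=\{x\in W_0:\ell(x)\ge k,\ x_i\in B_i\ (1\le i\le k),\ x_{k+1}\notin K\}$ (the last condition being vacuous if $\ell(x)=k$) and $C[K]=\{x\in W_0:x=\vec 0\text{ or }x_1\notin K\}$. The generalized cylinder set topology on $W_0$ is the topology generated by all these sets. $\mathcal P=\bigcup_{n\ge1}\mathcal B^n=\{p_1,p_2,\dots\}$ is a fixed enumeration, an element $(B_1,\dots,B_k)$ being written $B_1\times\cdots\times B_k$. The map $\alpha:W_0\to\{0,1\}^{\mathcal P}$ is $\alpha(x)(p)=1$ if $x\in Z[p,\emptyset]$ and $\alpha(x)(p)=0$ otherwise. On $\{0,1\}^{\mathcal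 P}$, writing $\mu_i=\mu(p_i)$, $d_{\mathrm{fin}}(\mu,\nu)=2^{-i}$ where $i\in\mathbb N$ is the smallest index with $\mu_i\ne\nu_i$, and $d_{\mathrm{fin}}(\mu,\nu)=0$ if $\mu=\nu$. *)

theory Defs
  imports "HOL-Analysis.Analysis"
begin

text \<open>Infinite words are functions on \<open>nat\<close> starting at 0, whereas letters are addressed by
  \<open>letter x 1, letter x 2, \<dots>\<close>; \<open>letter x i\<close> is meaningful only for \<open>1 \<le> i \<le> wlength x\<close>.\<close>

datatype 'a fiword = FinW "'a list" | InfW "nat \<Rightarrow> 'a"

primrec wlength :: "'a fiword \<Rightarrow> enat" where
  "wlength (FinW xs) = enat (length xs)"
| "wlength (InfW f) = \<infinity>"

primrec letter :: "'a fiword \<Rightarrow> nat \<Rightarrow> 'a" where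
  "letter (FinW xs) i = xs ! (i - 1)"
| "letter (InfW f) i = f (i - 1)"

definition W0 :: "'a topology \<Rightarrow> 'a fiword set" where
  "W0 X = {InfW f | f. range f \<subseteq> topspace X} \<union> {FinW xs | xs. set xs \<subseteq> topspace X}"

text \<open>A tuple \<open>(B\<^sub>1, \<dots>, B\<^sub>k)\<close> is encoded as the list \<open>[B\<^sub>1, \<dots>, B\<^sub>k]\<close>, whose entry
  \<open>B\<^sub>i\<close> is \<open>Bs ! (i - 1)\<close>.\<close>

definition cylZ :: "'a topology \<Rightarrow> 'a set list \<Rightarrow> 'a set \<Rightarrow> 'a fiword set" where
  "cylZ X Bs K = {x \<in> W0 X. enat (length Bs) \<le> wlength x
     \<and> (\<forall>i\<in>{1..length Bs}. letter x i \<in> Bs ! (i - 1))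
     \<and> (wlength x \<noteq> enat (length Bs) \<longrightarrow> letter x (length Bs + 1) \<notin> K)}"

definition cylC :: "'a topology \<Rightarrow> 'a set \<Rightarrow> 'a fiword set" where
  "cylC X K = {x \<in> W0 X. x = FinW [] \<or> letter x 1 \<notin> K}"

definition tuples :: "'a set set \<Rightarrow> 'a set list set" where
  "tuples \<B> = {Bs. Bs \<noteq> [] \<and> set Bs \<subseteq> \<B>}"

text \<open>The underlying set of this topology is all of \<open>W0 X\<close>, since \<open>cylC X {} = W0 X\<close>.\<close>

definition cylinder_topology :: "'a topology \<Rightarrow> 'a set set \<Rightarrow> 'a fiword topology" where
  "cylinder_topology X \<B> = topology_generated_by
     ({cylZ X Bs K | Bs K. Bs \<in> tuples \<B> \<and> compactin X K \<and> openin X K}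
      \<union> {cylC X K | K. compactin X K \<and> openin X K})"

text \<open>Elements of \<open>{0,1}\<^sup>P\<close> are extensional functions on \<open>P = tuples \<B>\<close>, so that equality
  of functions is equality on \<open>P\<close>.\<close>

definition alpha :: "'a topology \<Rightarrow> 'a set set \<Rightarrow> 'a fiword \<Rightarrow> 'a set list \<Rightarrow> nat" where
  "alpha X \<B> x = (\<lambda>p\<in>tuples \<B>. if x \<in> cylZ X p {} then 1 else 0)"

definition dfin :: "(nat \<Rightarrow> 'p) \<Rightarrow> ('p \<Rightarrow> nat) \<Rightarrow> ('p \<Rightarrow> nat) \<Rightarrow> real" where
  "dfin p \<mu> \<nu> =
     (if \<mu> = \<nu> then 0 else 1 / 2 ^ (LEAST i. 1 \<le> i \<and> \<mu> (p i) \<noteq> \<nu> (p i)))"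

definition word_dist ::
  "'a topology \<Rightarrow> 'a set set \<Rightarrow> (nat \<Rightarrow> 'a set list) \<Rightarrow> 'a fiword \<Rightarrow> 'a fiword \<Rightarrow> real" where
  "word_dist X \<B> p x y = dfin p (alpha X \<B> x) (alpha X \<B> y)"

end

theory Submission imports Defs begin

text \<open>All generators of the cylinder topology are obtained from the sets \<open>Z[p, \<emptyset>]\<close> by
  complements: \<open>Z[B, K] = Z[B, \<emptyset>] - Z[B \<times> K, \<emptyset>]\<close>, and a compact open \<open>K\<close> is a finite union of
  members of \<open>\<B>\<close>. Hence both topologies are the coarsest one making every \<open>Z[p, \<emptyset>]\<close> clopen: the
  ball of radius \<open>1 / 2 ^ n\<close> around \<open>x\<close> consists of the words lying in the same sets among
  \<open>Z[p\<^sub>1, \<emptyset>], \<dots>, Z[p\<^sub>n, \<emptyset>]\<close> as \<open>x\<close>. These sets separate words because \<open>\<B>\<close> is a basis of a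
  Hausdorff space.\<close>

section \<open>The function \<open>dfin\<close> along an enumeration\<close>

lemma dfin_nonneg: "0 \<le> dfin p \<mu> \<nu>"
  by (simp add: dfin_def)

lemma dfin_commute: "dfin p \<mu> \<nu> = dfin p \<nu> \<mu>"
  by (simp add: dfin_def eq_commute)

lemma dfin_eq_0_iff: "dfin p \<mu> \<nu> = 0 \<longleftrightarrow> \<mu> = \<nu>"
  by (simp add: dfin_def)

text \<open>For a first index \<open>L\<close> of difference the value is \<open>1 / 2 ^ L\<close>,
  so the bound says \<open>n < L\<close>. The assumption ensures that \<open>LEAST\<close> ranges
  over a nonempty set.\<close>

lemma dfin_less_iff:
  assumes "\<mu> \<noteq> \<nu> \<Longrightarrow> \<exists>i\<ge>1. \<mu> (p i) \<noteq> \<nu> (p i)"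
  shows "dfin p \<mu> \<nu> < 1 / 2 ^ n \<longleftrightarrow> (\<forall>i\<in>{1..n}. \<mu> (p i) = \<nu> (p i))"
proof (cases "\<mu> = \<nu>")
  case False
  let ?P = "\<lambda>i. 1 \<le> i \<and> \<mu> (p i) \<noteq> \<nu> (p i)"
  define L where "L = (LEAST i. ?P i)"
  have L: "?P L"
    using assms[OF False] unfolding L_def by (metis (mono_tags, lifting) LeastI)
  have L_le: "L \<le> i" if "?P i" for i
    using that unfolding L_def by (rule Least_le)
  have "dfin p \<mu> \<nu> < 1 / 2 ^ n \<longleftrightarrow> n < L"
    using False unfolding dfin_def L_def [symmetric] by (simp add: field_simps)
  also have "\<dots> \<longleftrightarrow> (\<forall>i\<in>{1..n}. \<mu> (p i) = \<nu> (p i))"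
    using L L_le by (meson atLeastAtMost_iff le_less_trans not_le)
  finally show ?thesis .
qed (simp add: dfin_def)

text \<open>At the first index where \<open>\<mu>\<close> and \<open>\<xi>\<close> differ,
  \<open>\<nu>\<close> differs from one of them, so one summand alone already reaches the left-hand
  side.\<close>

lemma dfin_triangle:
  assumes "\<And>\<mu> \<nu>. \<mu> \<in> A \<Longrightarrow> \<nu> \<in> A \<Longrightarrow> \<mu> \<noteq> \<nu> \<Longrightarrow> \<exists>i\<ge>1. \<mu> (p i) \<noteq> \<nu> (p i)"
    and A: "\<mu> \<in> A" "\<nu> \<in> A" "\<xi> \<in> A"
  shows "dfin p \<mu> \<xi> \<le> dfin p \<mu> \<nu> + dfin p \<nu> \<xi>"
proof (cases "\<mu> = \<xi>")
  case False
  let ?P = "\<lambda>i. 1 \<le> i \<and> \<mu> (p i) \<noteq> \<xi> (p i)"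
  define L where "L = (LEAST i. ?P i)"
  have L: "?P L"
    using assms(1)[OF A(1,3) False] unfolding L_def by (metis (mono_tags, lifting) LeastI)
  have eq: "dfin p \<mu> \<xi> = 1 / 2 ^ L"
    using False by (simp add: dfin_def L_def)
  have "\<mu> (p L) \<noteq> \<nu> (p L) \<or> \<nu> (p L) \<noteq> \<xi> (p L)"
    using L by auto
  then have "\<not> dfin p \<mu> \<nu> < 1 / 2 ^ L \<or> \<not> dfin p \<nu> \<xi> < 1 / 2 ^ L"
    using L dfin_less_iff[of \<mu> \<nu> p L, OF assms(1)] dfin_less_iff[of \<nu> \<xi> p L, OF assms(1)] A
    by fastforce
  then show ?thesis
    using eq dfin_nonneg[of p \<mu> \<nu>] dfin_nonneg[of p \<nu> \<xi>] by linarith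
qed (simp add: dfin_def add_nonneg_nonneg)

section \<open>Words and generalized cylinders\<close>

lemma fiword_eqI:
  assumes len: "wlength x = wlength y"
    and letter: "\<And>i. 1 \<le> i \<Longrightarrow> enat i \<le> wlength x \<Longrightarrow> letter x i = letter y i"
  shows "x = y"
proof (cases x)
  case (FinW xs)
  then obtain ys where y: "y = FinW ys"
    using len by (cases y) auto
  have "xs ! i = ys ! i" if "i < length xs" for i
    using letter[of "Suc i"] that FinW y by simp
  then show ?thesis
    using FinW y len by (simp add: list_eq_iff_nth_eq)
next
  case (InfW f)
  then obtain g where y: "y = InfW g"
    using len by (cases y) auto
  have "f i = g i" for i
    using letter[of "Suc i"] InfW y by simp
  then show ?thesis
    using InfW y by auto
qed

lemma letter_in_topspace:
  assumes "x \<in> W0 X" "1 \<le> i" "enat i \<le> wlength x"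
  shows "letter x i \<in> topspace X"
proof (cases x)
  case (FinW xs)
  with assms have "xs ! (i - 1) \<in> set xs"
    by (intro nth_mem) auto
  with assms FinW show ?thesis
    by (auto simp: W0_def)
qed (use assms in \<open>auto simp: W0_def\<close>)

lemma cylZ_subset_W0: "cylZ X Bs K \<subseteq> W0 X"
  by (auto simp: cylZ_def)

lemma cylZ_Nil_empty: "cylZ X [] {} = W0 X"
  by (auto simp: cylZ_def zero_enat_def[symmetric])

text \<open>Admitting the empty tuple merges both kinds of generators into one family.\<close>

lemma cylC_eq_cylZ_Nil: "cylC X K = cylZ X [] K"
proof -
  have "wlength x = 0 \<longleftrightarrow> x = FinW []" for x :: "'a fiword"
    by (cases x) (auto simp: zero_enat_def)
  then show ?thesis
    by (auto simp: cylC_def cylZ_def zero_enat_def[symmetric])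
qed

text \<open>The two added conditions together negate the last clause in the definition of
  \<open>cylZ X Bs K\<close>. Here \<open>K\<close> may be any set, not only a member of
  \<open>\<B>\<close>.\<close>

lemma cylZ_snoc_iff:
  "x \<in> cylZ X (Bs @ [K]) {} \<longleftrightarrow> x \<in> cylZ X Bs {} \<and> wlength x \<noteq> enat (length Bs)
     \<and> letter x (length Bs + 1) \<in> K"
proof -
  have len: "enat (Suc (length Bs)) \<le> wlength x \<longleftrightarrow>
      enat (length Bs) \<le> wlength x \<and> wlength x \<noteq> enat (length Bs)"
    by (cases "wlength x") auto
  have letters: "(\<forall>i\<in>{1..Suc (length Bs)}. letter x i \<in> (Bs @ [K]) ! (i - 1)) \<longleftrightarrow>
      (\<forall>i\<in>{1..length Bs}. letter x i \<in> Bs ! (i - 1)) \<and> letter x (length Bs + 1) \<in> K"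
    by (auto simp: atLeastAtMostSuc_conv nth_append)
  show ?thesis
    by (simp only: cylZ_def mem_Collect_eq length_append_singleton len letters) blast
qed

lemma cylZ_eq_diff: "cylZ X Bs K = cylZ X Bs {} - cylZ X (Bs @ [K]) {}"
  by (rule set_eqI, unfold Diff_iff cylZ_snoc_iff) (auto simp: cylZ_def)

lemma cylZ_snoc_Union: "cylZ X (Bs @ [\<Union>F]) {} = (\<Union>B\<in>F. cylZ X (Bs @ [B]) {})"
  by (auto simp: cylZ_snoc_iff)

lemma alpha_apply_eq_iff:
  assumes "q \<in> tuples \<B>"
  shows "alpha X \<B> x q = alpha X \<B> y q \<longleftrightarrow> (x \<in> cylZ X q {} \<longleftrightarrow> y \<in> cylZ X q {})"
  using assms by (simp add: alpha_def)

lemma alpha_eqI: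
  assumes "\<And>q. q \<in> tuples \<B> \<Longrightarrow> x \<in> cylZ X q {} \<longleftrightarrow> y \<in> cylZ X q {}"
  shows "alpha X \<B> x = alpha X \<B> y"
  using assms by (auto simp: alpha_def fun_eq_iff restrict_def)

section \<open>The cylinder topology and its clopen sets\<close>

lemma cylinder_topology_eq:
  "cylinder_topology X \<B> = topology_generated_by
     {cylZ X Bs K | Bs K. set Bs \<subseteq> \<B> \<and> compactin X K \<and> openin X K}"
  unfolding cylinder_topology_def
proof (rule arg_cong[where f = topology_generated_by], intro set_eqI iffI)
  fix S
  assume "S \<in> {cylZ X Bs K | Bs K. Bs \<in> tuples \<B> \<and> compactin X K \<and> openin X K}
      \<union> {cylC X K | K. compactin X K \<and> openin X K}"
  then show "S \<in> {cylZ X Bs K | Bs K. set Bs \<subseteq> \<B> \<and> compactin X K \<and> openin X K}"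
    by (force simp: tuples_def cylC_eq_cylZ_Nil)
next
  fix S
  assume "S \<in> {cylZ X Bs K | Bs K. set Bs \<subseteq> \<B> \<and> compactin X K \<and> openin X K}"
  then show "S \<in> {cylZ X Bs K | Bs K. Bs \<in> tuples \<B> \<and> compactin X K \<and> openin X K}
      \<union> {cylC X K | K. compactin X K \<and> openin X K}"
    by (auto simp: tuples_def cylC_eq_cylZ_Nil)
qed

lemma topspace_cylinder_topology: "topspace (cylinder_topology X \<B>) = W0 X"
proof -
  have "cylZ X [] {} \<in> {cylZ X Bs K | Bs K. set Bs \<subseteq> \<B> \<and> compactin X K \<and> openin X K}"
    by force
  then show ?thesis
    unfolding cylinder_topology_eq topology_generated_by_topspace
    using cylZ_Nil_empty cylZ_subset_W0 by fast
qed

lemma openin_cylinder_cylZ: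
  assumes "set Bs \<subseteq> \<B>" "compactin X K" "openin X K"
  shows "openin (cylinder_topology X \<B>) (cylZ X Bs K)"
  unfolding cylinder_topology_eq by (rule topology_generated_by_Basis) (use assms in auto)

text \<open>Induction on the last entry: a word outside \<open>cylZ X (Bs @ [B]) {}\<close> either
  lies outside \<open>cylZ X Bs {}\<close> or lies in \<open>cylZ X Bs B\<close>, which is a
  generator because \<open>B\<close> is compact open.\<close>

lemma openin_cylinder_Diff_cylZ:
  assumes \<B>: "\<And>B. B \<in> \<B> \<Longrightarrow> compactin X B \<and> openin X B" and "set Bs \<subseteq> \<B>"
  shows "openin (cylinder_topology X \<B>) (W0 X - cylZ X Bs {})"
  using assms(2)
proof (induction Bs rule: rev_induct)
  case Nil
  then show ?case
    by (simp add: cylZ_Nil_empty)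
next
  case (snoc B Bs)
  have "W0 X - cylZ X (Bs @ [B]) {} = (W0 X - cylZ X Bs {}) \<union> cylZ X Bs B"
    using cylZ_subset_W0[of X Bs] unfolding cylZ_eq_diff[of X Bs B] by (auto simp: cylZ_snoc_iff)
  with snoc show ?case
    by (auto intro!: openin_Un openin_cylinder_cylZ simp: \<B>)
qed

text \<open>The members of \<open>\<B>\<close> inside \<open>K\<close> cover it; a finite subcover
  cannot leave \<open>K\<close>.\<close>

lemma compact_open_eq_finite_Union:
  assumes basis: "\<And>U x. openin X U \<Longrightarrow> x \<in> U \<Longrightarrow> \<exists>B\<in>\<B>. x \<in> B \<and> B \<subseteq> U"
    and \<B>: "\<And>B. B \<in> \<B> \<Longrightarrow> openin X B"
    and K: "compactin X K" "openin X K"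
  obtains F where "finite F" "F \<subseteq> \<B>" "K = \<Union>F"
proof -
  let ?U = "{B \<in> \<B>. B \<subseteq> K}"
  have "K \<subseteq> \<Union>?U"
    using basis[OF K(2)] by blast
  then obtain F where "finite F" "F \<subseteq> ?U" "K \<subseteq> \<Union>F"
    using compactinD[OF K(1), of ?U] \<B> by auto
  then show thesis
    by (intro that[of F]) auto
qed

text \<open>Each of the first \<open>Suc n\<close> letters receives a basic neighbourhood, the last
  one chosen inside \<open>U\<close>. This supplies the separating cylinders below.\<close>

lemma obtain_tuple_around:
  assumes basis: "\<And>U x. openin X U \<Longrightarrow> x \<in> U \<Longrightarrow> \<exists>B\<in>\<B>. x \<in> B \<and> B \<subseteq> U"
    and y: "y \<in> W0 X" "enat (Suc n) \<le> wlength y"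
    and U: "openin X U" "letter y (Suc n) \<in> U"
  obtains Bs where "Bs \<in> tuples \<B>" "length Bs = Suc n" "y \<in> cylZ X Bs {}" "Bs ! n \<subseteq> U"
proof -
  have "\<exists>B\<in>\<B>. letter y (Suc i) \<in> B \<and> (i = n \<longrightarrow> B \<subseteq> U)" if "i \<le> n" for i
  proof (cases "i = n")
    case True
    then show ?thesis
      using basis[OF U] by blast
  next
    case False
    have "enat (Suc i) \<le> wlength y"
      using y(2) that by (meson Suc_le_mono enat_ord_simps(1) order_trans)
    then have "letter y (Suc i) \<in> topspace X"
      using letter_in_topspace[OF y(1)] by simp
    with False show ?thesis
      using basis[OF openin_topspace] by blast
  qed
  then obtain b where b: "\<And>i. i \<le> n \<Longrightarrow> b i \<in> \<B> \<and> letter y (Suc i) \<in> b i \<and> (i = n \<longrightarrow> b i \<subseteq> U)"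
    by metis
  let ?Bs = "map b [0..<Suc n]"
  have "letter y i \<in> ?Bs ! (i - 1)" if "i \<in> {1..Suc n}" for i
    using that b[of "i - 1"] by (auto simp: nth_append simp del: upt_Suc)
  then have "y \<in> cylZ X ?Bs {}"
    using y by (simp add: cylZ_def del: upt_Suc)
  moreover have "?Bs \<in> tuples \<B>"
    using b by (auto simp: tuples_def)
  ultimately show thesis
    using b[of n] by (intro that[of ?Bs]) (auto simp: nth_append)
qed

text \<open>This gives injectivity of \<open>alpha\<close> on \<open>W0 X\<close>. Words of
  different lengths are separated by a tuple longer than the shorter word, words of equal length by
  disjoint neighbourhoods of two differing letters.\<close>

lemma ex_separating_tuple:
  assumes haus: "Hausdorff_space X"
    and basis: "\<And>U x. openin X U \<Longrightarrow> x \<in> U \<Longrightarrow> \<exists>B\<in>\<B>. x \<in> B \<and> B \<subseteq> U"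
    and "x \<in> W0 X" "y \<in> W0 X" "x \<noteq> y"
  shows "\<exists>q\<in>tuples \<B>. (x \<in> cylZ X q {}) \<noteq> (y \<in> cylZ X q {})"
  using assms(3-)
proof (induction "wlength x" "wlength y" arbitrary: x y rule: linorder_wlog)
  case sym
  then show ?case
    by metis
next
  case le
  show ?case
  proof (cases "wlength x < wlength y")
    case True
    then obtain n where n: "wlength x = enat n"
      by (cases "wlength x") auto
    with True have len: "enat (Suc n) \<le> wlength y"
      by (metis Suc_ile_eq)
    then have "letter y (Suc n) \<in> topspace X"
      using letter_in_topspace[OF \<open>y \<in> W0 X\<close> _ len] by simp
    \<comment> \<open>With the whole space as \<open>U\<close> only the length of the tuple matters:
      \<open>x\<close> is too short to lie in the cylinder.\<close>
    then obtain Bs where Bs: "Bs \<in> tuples \<B>" "length Bs = Suc n" "y \<in> cylZ X Bs {}"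
      using obtain_tuple_around[OF basis \<open>y \<in> W0 X\<close> len openin_topspace] by blast
    then have "x \<notin> cylZ X Bs {}"
      using n by (simp add: cylZ_def)
    with Bs show ?thesis
      by blast
  next
    case False
    with le have len: "wlength x = wlength y"
      by simp
    then obtain i where i: "1 \<le> i" "enat i \<le> wlength x" "letter x i \<noteq> letter y i"
      using fiword_eqI \<open>x \<noteq> y\<close> by blast
    then obtain n where n: "i = Suc n"
      by (cases i) auto
    have "letter x i \<in> topspace X" "letter y i \<in> topspace X"
      using letter_in_topspace[OF _ i(1), of _ X] i(2) le len by auto
    then obtain U V where UV: "openin X U" "openin X V" "letter x i \<in> U" "letter y i \<in> V"
        "disjnt U V"
      using haus i(3) unfolding Hausdorff_space_def by meson
    then obtain Bs where Bs: "Bs \<in> tuples \<B>" "length Bs = i" "x \<in> cylZ X Bs {}" "Bs ! (i - 1) \<subseteq> U"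
      using obtain_tuple_around[OF basis \<open>x \<in> W0 X\<close>, of n U] i n by auto
    have "y \<notin> cylZ X Bs {}"
    proof
      assume "y \<in> cylZ X Bs {}"
      then have "letter y i \<in> Bs ! (i - 1)"
        using Bs(2) i(1) by (simp add: cylZ_def)
      with Bs(4) UV(4,5) show False
        by (auto simp: disjnt_iff)
    qed
    with Bs show ?thesis
      by blast
  qed
qed

section \<open>Comparison of the metric and cylinder topologies\<close>

theorem corollary2p12:
  fixes X :: "'a topology" and \<B> :: "'a set set" and p :: "nat \<Rightarrow> 'a set list"
  assumes "infinite (topspace X)"
    and "locally_compact_space X"
    and "Hausdorff_space X"
    and "countable \<B>"
    and "\<And>B. B \<in> \<B> \<Longrightarrow> compactin X B \<and> openin X B"
    and "\<And>U x. openin X U \<Longrightarrow> x \<in> U \<Longrightarrow> \<exists>B\<in>\<B>. x \<in> B \<and> B \<subseteq> U"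
    and "\<And>F. finite F \<Longrightarrow> F \<noteq> {} \<Longrightarrow> F \<subseteq> \<B> \<Longrightarrow> \<Inter>F \<in> \<B>"
    and "p ` {1..} = tuples \<B>"
  shows "Metric_space (W0 X) (word_dist X \<B> p)
    \<and> Metric_space.mtopology (W0 X) (word_dist X \<B> p) = cylinder_topology X \<B>"
proof -
  note \<B> = assms(5) and basis = assms(6) and p = assms(8)
  let ?d = "word_dist X \<B> p"
  let ?C = "cylinder_topology X \<B>"
  \<comment> \<open>By extensionality the functions differ at some tuple, and every tuple is
    \<open>p i\<close> with \<open>1 \<le> i\<close>; the value \<open>p 0\<close> is
    arbitrary.\<close>
  have alpha_neq: "\<exists>i\<ge>1. alpha X \<B> x (p i) \<noteq> alpha X \<B> y (p i)"
    if "alpha X \<B> x \<noteq> alpha X \<B> y" for x y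
  proof -
    obtain q where q: "q \<in> tuples \<B>" "(x \<in> cylZ X q {}) \<noteq> (y \<in> cylZ X q {})"
      using alpha_eqI \<open>alpha X \<B> x \<noteq> alpha X \<B> y\<close> by blast
    moreover obtain i where "1 \<le> i" "q = p i"
      using q(1) p by (metis atLeast_iff imageE)
    ultimately show ?thesis
      using alpha_apply_eq_iff by blast
  qed
  have p_tuples: "p i \<in> tuples \<B>" if "1 \<le> i" for i
    using that p by auto
  have less_iff: "?d x y < 1 / 2 ^ n \<longleftrightarrow>
      (\<forall>i\<in>{1..n}. x \<in> cylZ X (p i) {} \<longleftrightarrow> y \<in> cylZ X (p i) {})" for x y n
    using dfin_less_iff[of "alpha X \<B> x" "alpha X \<B> y" p n] alpha_neq[of x y] p_tuples
    by (simp add: word_dist_def alpha_apply_eq_iff)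
  interpret Metric_space "W0 X" ?d
  proof
    fix x y z
    show "0 \<le> ?d x y"
      by (simp add: word_dist_def dfin_nonneg)
    show "?d x y = ?d y x"
      unfolding word_dist_def by (rule dfin_commute)
    \<comment> \<open>Definiteness is where separation of words, and thus the Hausdorff property,
      enters.\<close>
    show "?d x y = 0 \<longleftrightarrow> x = y" if "x \<in> W0 X" "y \<in> W0 X"
      using ex_separating_tuple[OF assms(3) basis that] alpha_apply_eq_iff
      unfolding word_dist_def dfin_eq_0_iff by metis
    show "?d x z \<le> ?d x y + ?d y z"
      unfolding word_dist_def
      by (rule dfin_triangle[where A = "range (alpha X \<B>)"]) (use alpha_neq in auto)
  qed
  \<comment> \<open>Agreement on \<open>p i\<close> is one of the conditions that define the ball of
    radius \<open>1 / 2 ^ i\<close>.\<close>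
  have ball: "{y \<in> W0 X. x \<in> cylZ X q {} \<longleftrightarrow> y \<in> cylZ X q {}} \<supseteq> mball x r"
    if "q = p i" "1 \<le> i" "r = 1 / 2 ^ i" for x q i r
    using that less_iff[of x _ i] by (auto simp: mball_def)
  have clopen: "openin mtopology (cylZ X Bs {}) \<and> openin mtopology (W0 X - cylZ X Bs {})"
    if "set Bs \<subseteq> \<B>" for Bs
  \<comment> \<open>The empty tuple is not enumerated by \<open>p\<close>; its cylinder is the whole
    space.\<close>
  proof (cases "Bs = []")
    case True
    then show ?thesis
      using openin_topspace[of mtopology] by (simp add: cylZ_Nil_empty)
  next
    case False
    with that have "Bs \<in> tuples \<B>"
      by (simp add: tuples_def)
    then obtain i where i: "1 \<le> i" "Bs = p i"
      using p by (metis atLeast_iff imageE)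
    \<comment> \<open>Membership in the cylinder is constant on a ball around each point, so the
      cylinder and its complement are both open.\<close>
    have "\<exists>r>0. mball x r \<subseteq> {y \<in> W0 X. x \<in> cylZ X Bs {} \<longleftrightarrow> y \<in> cylZ X Bs {}}" for x
      by (rule exI[of _ "1 / 2 ^ i"]) (use ball[OF i(2,1)] in auto)
    then show ?thesis
      using cylZ_subset_W0[of X Bs "{}"] unfolding openin_mtopology by blast
  qed
  have "openin ?C S" if "openin mtopology S" for S
  proof (subst openin_subopen, intro ballI)
    fix x assume "x \<in> S"
    with that obtain r where r: "0 < r" "mball x r \<subseteq> S" and x: "x \<in> W0 X"
      unfolding openin_mtopology by blast
    obtain n where n: "1 / 2 ^ n < r"
      using real_arch_pow_inv[OF r(1), of "1 / 2"] by (auto simp: power_one_over)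
    \<comment> \<open>\<open>?Z i\<close> is the one of the two complementary clopen sets that
      contains \<open>x\<close>, so \<open>?D\<close> is the ball of radius \<open>1 / 2 ^ n\<close>
      around \<open>x\<close>. The factor \<open>W0 X\<close> in \<open>?D\<close> covers
      \<open>n = 0\<close>.\<close>
    let ?Z = "\<lambda>i. if x \<in> cylZ X (p i) {} then cylZ X (p i) {} else W0 X - cylZ X (p i) {}"
    let ?D = "W0 X \<inter> (\<Inter>i\<in>{1..n}. ?Z i)"
    have Z: "openin ?C (?Z i)" if "i \<in> {1..n}" for i
    proof -
      have "set (p i) \<subseteq> \<B>"
        using p_tuples[of i] that by (simp add: tuples_def)
      then show ?thesis
        using openin_cylinder_cylZ[of "p i"] openin_cylinder_Diff_cylZ[OF \<B>] by simp
    qed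
    have "openin ?C (topspace ?C \<inter> (\<Inter>i\<in>{1..n}. ?Z i))"
      by (intro openin_Int_Inter finite_imageI finite_atLeastAtMost openin_topspace)
        (erule imageE, simp only: Z)
    then have "openin ?C ?D"
      by (simp only: topspace_cylinder_topology)
    moreover have "x \<in> ?D"
      using x by auto
    moreover have "?D \<subseteq> S"
    proof
      fix y assume y: "y \<in> ?D"
      then have "\<forall>i\<in>{1..n}. x \<in> cylZ X (p i) {} \<longleftrightarrow> y \<in> cylZ X (p i) {}"
        by (auto split: if_splits)
      then have "?d x y < r"
        using less_iff n by (meson less_trans)
      then show "y \<in> S"
        using r x y by (auto simp: subset_iff)
    qed
    ultimately show "\<exists>T. openin ?C T \<and> x \<in> T \<and> T \<subseteq> S"
      by blast
  qed
  moreover have "openin mtopology S" if "openin ?C S" for S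
  proof -
    have "openin mtopology (cylZ X Bs K)"
      if Bs: "set Bs \<subseteq> \<B>" and K: "compactin X K" "openin X K" for Bs K
    proof -
      obtain F where F: "finite F" "F \<subseteq> \<B>" "K = \<Union>F"
        using compact_open_eq_finite_Union[OF basis _ K] \<B> by blast
      \<comment> \<open>Since \<open>K\<close> need not belong to \<open>\<B>\<close>,
        \<open>clopen\<close> is applied to the members of \<open>F\<close>; finiteness of
        \<open>F\<close> then keeps the union closed.\<close>
      have "closedin mtopology (cylZ X (Bs @ [B]) {})" if "B \<in> F" for B
        unfolding closedin_def using clopen[of "Bs @ [B]"] that F Bs cylZ_subset_W0[of X] by auto
      then have "closedin mtopology (cylZ X (Bs @ [K]) {})"
        unfolding F(3) cylZ_snoc_Union using F(1) by (intro closedin_Union) auto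
      then show ?thesis
        unfolding cylZ_eq_diff[of X Bs K] using clopen[OF Bs] by (intro openin_diff) auto
    qed
    then have *: "openin mtopology T"
      if "T \<in> {cylZ X Bs K | Bs K. set Bs \<subseteq> \<B> \<and> compactin X K \<and> openin X K}" for T
      using that by fast
    have "generate_topology_on
        {cylZ X Bs K | Bs K. set Bs \<subseteq> \<B> \<and> compactin X K \<and> openin X K} S"
      using that unfolding cylinder_topology_eq openin_topology_generated_by_iff .
    \<comment> \<open>A topology containing all generators contains the topology that they
      generate.\<close>
    from generate_topology_on_coarsest[OF istopology_openin * this] show ?thesis .
  qed
  ultimately have "mtopology = ?C"
    by (auto simp: topology_eq)
  with Metric_space_axioms show ?thesis
    by blast
qed

end
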